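(* Let $R$ be a discrete valuation ring with residue field $k$ and fraction field $K$. Let $\widetilde{\mathfrak v}=(\widetilde V_i,\tilde v_i,\tilde v^i)_{i\in\mathbb Z}$ be a smoothing over $R$ of a colinked chain $\mathfrak v=(V_i,v_i,v^i)_{i\in\mathbb Z}$ with finite cosupport, and let $\mathfrak w=(W_i)_{i\in\mathbb Z}$ be an exact subrepresentation of $\mathfrak v$ of pure dimension $1$. Then there is a subrepresentation $\widetilde{\mathfrak w}\subseteq\widetilde{\mathfrak v}$ specializing to $\mathfrak w$, i.e. there are submodules $\widetilde W_i\subseteq\widetilde V_i$, each generated by an element $x_i$ whose residue in $V_i$ generates $W_i$, such that $\tilde v^i(\widetilde W_i)\subseteq\widetilde W_{i+1}$ and $\tilde v_i(\widetilde W_{i+1})\subseteq\widetilde W_i$ for all $i\in\mathbb Z$.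
   Context: $\mathcal Z$ is the quiver with vertex set $\mathbb Z$ and arrows $\alpha^i\colon i\to i+1$, $\alpha_i\colon i+1\to i$ ($i\in\mathbb Z$). A representation $(V_i,v_i,v^i)$ of $\mathcal Z$ in a category consists of objects $V_i$ and morphisms $v^i\colon V_i\to V_{i+1}$, $v_i\colon V_{i+1}\to V_i$. Over $k$ (finite-dimensional vector spaces), compositions $v^i_j$ are $v^{j-1}\circ\cdots\circ v^i$ ($j>i$), $v_j\circ\cdots\circ v_{i-1}$ ($j<i$), identity ($j=i$). A colinked chain satisfies $v_iv^i=0$, $v^iv_i=0$ and $\mathrm{Im}(v_i)+\mathrm{Im}(v^{i-1})=V_i$ for all $i$. A finite cosupport is a finite $H\subseteq\mathbb Z$ such that for each $i$ there is $j\in H$ with $v^i_j$ injective. A subrepresentation $\mathfrak w$ is a family of subspaces $W_i\subseteq V_i$ with $v^i(W_i)\subseteq W_{i+1}$, $v_i(W_{i+1})\subseteq W_i$; it has pure dimension $1$ if all $W_i$ are one-dimensional, and is exact if the restricted maps $w^i,w_i$ satisfy $\ker(w^i)=\mathrm{Im}(w_i)$, $\ker(w_i)=\mathrm{Im}(w^i)$ for all $i$. A representation of $\mathcal Z$ over a field is general if $v_i\circ v^i$ and $v^i\circ v_i$ are nonzero scalar multiples of the identity for every $i$. If $\widetilde{\mathfrak v}$ is a representation of $\mathcal Z$ in free $R$-modules of finite rank, its specialization is $\widetilde{\mathfrak v}\otimes_R k$; $\widetilde{\mathfrak v}$ is a smoothing of $\mathfrak v$ over $R$ if $\widetilde{\mathfrak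 v}\otimes_R k=\mathfrak v$ and $\widetilde{\mathfrak v}\otimes_R K$ is general. *)

theory Defs
  imports "Jordan_Normal_Form.Matrix"
begin

text \<open>Representations of the quiver Z in finite free modules are encoded by
  ranks n :: int => nat, matrices a i of the upper arrows (V_i -> V_(i+1))
  and matrices b i of the lower arrows (V_(i+1) -> V_i).\<close>

definition is_rep :: "(int \<Rightarrow> nat) \<Rightarrow> (int \<Rightarrow> 'a::semiring_1 mat) \<Rightarrow> (int \<Rightarrow> 'a mat) \<Rightarrow> bool" where
  "is_rep n a b \<longleftrightarrow> (\<forall>i. a i \<in> carrier_mat (n (i+1)) (n i) \<and> b i \<in> carrier_mat (n i) (n (i+1)))"

text \<open>Discrete valuation ring (type-class idiom): a domain with a uniformizer t,
  i.e. t nonzero non-unit with every nonzero element of the form u * t^m, u a unit.\<close>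
definition is_dvr :: "'r::idom itself \<Rightarrow> bool" where
  "is_dvr _ \<longleftrightarrow> (\<exists>t::'r. t \<noteq> 0 \<and> \<not> t dvd 1 \<and>
      (\<forall>x. x \<noteq> 0 \<longrightarrow> (\<exists>u m. u dvd 1 \<and> x = u * t ^ m)))"

definition is_ring_hom :: "('a::ring_1 \<Rightarrow> 'b::ring_1) \<Rightarrow> bool" where
  "is_ring_hom f \<longleftrightarrow> f 1 = 1 \<and> (\<forall>x y. f (x + y) = f x + f y) \<and> (\<forall>x y. f (x * y) = f x * f y)"

text \<open>pi is the residue map R -> k = R/m (surjective ring hom whose kernel is the
  maximal ideal of non-units).\<close>
definition is_residue_map :: "('r::idom \<Rightarrow> 'k::field) \<Rightarrow> bool" where
  "is_residue_map \<pi> \<longleftrightarrow> is_ring_hom \<pi> \<and> surj \<pi> \<and> (\<forall>x. \<pi> x = 0 \<longleftrightarrow> \<not> x dvd 1)"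

text \<open>iota is the inclusion of R into its fraction field K.\<close>
definition is_fraction_field_map :: "('r::idom \<Rightarrow> 'K::field) \<Rightarrow> bool" where
  "is_fraction_field_map \<iota> \<longleftrightarrow> is_ring_hom \<iota> \<and> inj \<iota> \<and>
     (\<forall>z. \<exists>x y. y \<noteq> 0 \<and> z = \<iota> x / \<iota> y)"

text \<open>Compositions v^i_j.  upcomp: a (i+k-1) * ... * a i : V_i -> V_(i+k);
  downcomp: b (i-k) * ... * b (i-1) : V_i -> V_(i-k).\<close>
fun upcomp :: "(int \<Rightarrow> nat) \<Rightarrow> (int \<Rightarrow> 'a::semiring_1 mat) \<Rightarrow> int \<Rightarrow> nat \<Rightarrow> 'a mat" where
  "upcomp n a i 0 = 1\<^sub>m (n i)"
| "upcomp n a i (Suc k) = a (i + int k) * upcomp n a i k"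

fun downcomp :: "(int \<Rightarrow> nat) \<Rightarrow> (int \<Rightarrow> 'a::semiring_1 mat) \<Rightarrow> int \<Rightarrow> nat \<Rightarrow> 'a mat" where
  "downcomp n b i 0 = 1\<^sub>m (n i)"
| "downcomp n b i (Suc k) = b (i - int k - 1) * downcomp n b i k"

definition comp_map :: "(int \<Rightarrow> nat) \<Rightarrow> (int \<Rightarrow> 'a::semiring_1 mat) \<Rightarrow> (int \<Rightarrow> 'a mat) \<Rightarrow> int \<Rightarrow> int \<Rightarrow> 'a mat" where
  "comp_map n a b i j = (if i \<le> j then upcomp n a i (nat (j - i)) else downcomp n b i (nat (i - j)))"

definition colinked_chain :: "(int \<Rightarrow> nat) \<Rightarrow> (int \<Rightarrow> 'k::field mat) \<Rightarrow> (int \<Rightarrow> 'k mat) \<Rightarrow> bool" where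
  "colinked_chain n a b \<longleftrightarrow>
     (\<forall>i. b i * a i = 0\<^sub>m (n i) (n i) \<and> a i * b i = 0\<^sub>m (n (i+1)) (n (i+1)) \<and>
          (\<forall>x \<in> carrier_vec (n i). \<exists>y \<in> carrier_vec (n (i+1)). \<exists>z \<in> carrier_vec (n (i-1)).
              x = b i *\<^sub>v y + a (i-1) *\<^sub>v z))"

definition finite_cosupport :: "(int \<Rightarrow> nat) \<Rightarrow> (int \<Rightarrow> 'k::field mat) \<Rightarrow> (int \<Rightarrow> 'k mat) \<Rightarrow> int set \<Rightarrow> bool" where
  "finite_cosupport n a b H \<longleftrightarrow> finite H \<and>
     (\<forall>i. \<exists>j\<in>H. inj_on (\<lambda>x. comp_map n a b i j *\<^sub>v x) (carrier_vec (n i)))"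

definition general_rep :: "(int \<Rightarrow> nat) \<Rightarrow> (int \<Rightarrow> 'k::field mat) \<Rightarrow> (int \<Rightarrow> 'k mat) \<Rightarrow> bool" where
  "general_rep n a b \<longleftrightarrow>
     (\<forall>i. (\<exists>c. c \<noteq> 0 \<and> b i * a i = c \<cdot>\<^sub>m 1\<^sub>m (n i)) \<and>
          (\<exists>d. d \<noteq> 0 \<and> a i * b i = d \<cdot>\<^sub>m 1\<^sub>m (n (i+1))))"

definition is_subspace :: "nat \<Rightarrow> 'k::field vec set \<Rightarrow> bool" where
  "is_subspace m W \<longleftrightarrow> W \<subseteq> carrier_vec m \<and> 0\<^sub>v m \<in> W \<and>
     (\<forall>x\<in>W. \<forall>y\<in>W. x + y \<in> W) \<and> (\<forall>c. \<forall>x\<in>W. c \<cdot>\<^sub>v x \<in> W)"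

definition subrep :: "(int \<Rightarrow> nat) \<Rightarrow> (int \<Rightarrow> 'k::field mat) \<Rightarrow> (int \<Rightarrow> 'k mat) \<Rightarrow> (int \<Rightarrow> 'k vec set) \<Rightarrow> bool" where
  "subrep n a b W \<longleftrightarrow> (\<forall>i. is_subspace (n i) (W i) \<and>
      (\<lambda>x. a i *\<^sub>v x) ` W i \<subseteq> W (i+1) \<and> (\<lambda>y. b i *\<^sub>v y) ` W (i+1) \<subseteq> W i)"

text \<open>Pure dimension 1: every W_i is one-dimensional, i.e. spanned by a nonzero vector.\<close>
definition pure_dim_one :: "(int \<Rightarrow> nat) \<Rightarrow> (int \<Rightarrow> 'k::field vec set) \<Rightarrow> bool" where
  "pure_dim_one n W \<longleftrightarrow> (\<forall>i. \<exists>w. w \<noteq> 0\<^sub>v (n i) \<and> W i = {c \<cdot>\<^sub>v w | c. True})"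

definition exact_subrep :: "(int \<Rightarrow> nat) \<Rightarrow> (int \<Rightarrow> 'k::field mat) \<Rightarrow> (int \<Rightarrow> 'k mat) \<Rightarrow> (int \<Rightarrow> 'k vec set) \<Rightarrow> bool" where
  "exact_subrep n a b W \<longleftrightarrow> (\<forall>i.
      {x \<in> W i. a i *\<^sub>v x = 0\<^sub>v (n (i+1))} = (\<lambda>y. b i *\<^sub>v y) ` W (i+1) \<and>
      {y \<in> W (i+1). b i *\<^sub>v y = 0\<^sub>v (n i)} = (\<lambda>x. a i *\<^sub>v x) ` W i)"

end

theory Submission
  imports Defs
begin

(* Let t be a uniformizer of R. Since the residues of A_i and B_i compose to zero while over K the
   products B_i A_i and A_i B_i are nonzero scalars, these scalars are nonzero elements of (t).
   Orient the step i -> i+1 forward if the residue of A_i does not vanish on W_i; otherwise exactness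
   makes W_i the image of W_(i+1) under the residue of B_i. On a finite window one builds zigzag
   families x_i, linked by A_i x_i = x_(i+1) on forward steps and by B_i x_(i+1) = x_i on backward
   steps, whose residues generate the W_i. A forward step simply applies A_i. For a backward step,
   a lift Y of a generator of W_(i+1) satisfies B_i Y = x_i mod t, and the error is absorbed into the
   family: by the colinked condition and a Nakayama argument (B_j A_j divides a power of t), every
   vector of R^(n_j) has the form x_j + B_j z with x a zigzag family. Outside the finite cosupport
   the residues of A_i (to the left) and of B_i (to the right) are injective, so preimages extend the
   family to all of Z. As A_i B_i and B_i A_i are scalars, the lines R x_i form a subrepresentation. *)

abbreviation multiples :: "'a::times vec \<Rightarrow> 'a vec set" where
  "multiples v \<equiv> {c \<cdot>\<^sub>v v | c. True}"

lemma mult_mat_vec_smult: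
  assumes "A \<in> carrier_mat nr nc" "v \<in> carrier_vec nc"
  shows "A *\<^sub>v (k \<cdot>\<^sub>v v) = (k::'a::comm_ring_1) \<cdot>\<^sub>v (A *\<^sub>v v)"
  using assms by (intro eq_vecI) (auto simp: scalar_prod_smult_right)

lemma smult_one_mat_mult_vec:
  "v \<in> carrier_vec n \<Longrightarrow> (c \<cdot>\<^sub>m 1\<^sub>m n) *\<^sub>v v = (c::'a::comm_ring_1) \<cdot>\<^sub>v v"
  by (intro eq_vecI) (auto simp: scalar_prod_smult_left)

lemma mult_mat_vec_zero: "M \<in> carrier_mat a b \<Longrightarrow> M *\<^sub>v 0\<^sub>v b = (0\<^sub>v a :: 'a::semiring_0 vec)"
  by (intro eq_vecI) (auto simp: scalar_prod_def)

lemma (in semiring_hom) vec_hom_add: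
  "v \<in> carrier_vec N \<Longrightarrow> w \<in> carrier_vec N \<Longrightarrow> vec\<^sub>h (v + w) = vec\<^sub>h v + vec\<^sub>h w"
  by (intro eq_vecI) (auto simp: hom_add)

lemma smult_vec_left_cancel:
  assumes "(c::'a::idom) \<noteq> 0" "v \<in> carrier_vec N" "w \<in> carrier_vec N" "c \<cdot>\<^sub>v v = c \<cdot>\<^sub>v w"
  shows "v = w"
proof (rule eq_vecI)
  fix l assume "l < dim_vec w"
  then show "v $ l = w $ l"
    using arg_cong[OF assms(4), of "\<lambda>u. u $ l"] assms(1-3) by simp
qed (use assms in simp)

lemma self_mem_multiples: "v \<in> multiples (v :: 'a::ring_1 vec)"
proof -
  have "v = 1 \<cdot>\<^sub>v v" by simp
  then show ?thesis by blast
qed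

lemma multiples_smult:
  assumes "(g::'a::field) \<noteq> 0"
  shows "multiples (g \<cdot>\<^sub>v w) = multiples w"
proof -
  have "c \<cdot>\<^sub>v (g \<cdot>\<^sub>v w) \<in> multiples w" for c
    by (auto simp: smult_smult_assoc)
  moreover have "c \<cdot>\<^sub>v w \<in> multiples (g \<cdot>\<^sub>v w)" for c
  proof -
    have "c \<cdot>\<^sub>v w = (c / g) \<cdot>\<^sub>v (g \<cdot>\<^sub>v w)" using assms by (simp add: smult_smult_assoc)
    then show ?thesis by blast
  qed
  ultimately show ?thesis by blast
qed

lemma multiples_eq_of_mem:
  fixes v w :: "'a::field vec"
  assumes "v \<in> multiples w" "v \<noteq> 0\<^sub>v (dim_vec w)"
  shows "multiples v = multiples w"
proof -
  obtain c where v: "v = c \<cdot>\<^sub>v w" using assms(1) by blast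
  have "c \<noteq> 0" using assms(2) unfolding v by (auto intro!: eq_vecI)
  then show ?thesis unfolding v by (rule multiples_smult)
qed

lemma multiples_eq_of_injective:
  fixes M :: "'a::field mat"
  assumes M: "M \<in> carrier_mat a b" and inj: "inj_on ((*\<^sub>v) M) (carrier_vec b)"
    and w: "w \<in> carrier_vec b" "w \<noteq> 0\<^sub>v b" and u: "u \<in> carrier_vec b"
    and Mw: "M *\<^sub>v w \<in> multiples (M *\<^sub>v u)"
  shows "multiples w = multiples u"
proof -
  obtain c where "M *\<^sub>v w = c \<cdot>\<^sub>v (M *\<^sub>v u)" using Mw by blast
  also have "\<dots> = M *\<^sub>v (c \<cdot>\<^sub>v u)" using M u by (simp add: mult_mat_vec)
  finally have "w = c \<cdot>\<^sub>v u" using inj w u by (auto dest: inj_onD)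
  then show ?thesis using w u by (intro multiples_eq_of_mem) auto
qed

lemma mult_multiples_subset:
  fixes M :: "'a::comm_ring_1 mat"
  assumes "M \<in> carrier_mat a b" "u \<in> carrier_vec b" "M *\<^sub>v u \<in> multiples v"
  shows "(\<lambda>y. M *\<^sub>v y) ` multiples u \<subseteq> multiples v"
  using assms by (auto simp: mult_mat_vec_smult smult_smult_assoc)

lemma carrier_vec_subset_nakayama:
  fixes S :: "'a::comm_ring_1 vec set"
  assumes S: "S \<subseteq> carrier_vec N"
    and add: "\<And>x y. x \<in> S \<Longrightarrow> y \<in> S \<Longrightarrow> x + y \<in> S"
    and smult: "\<And>r x. x \<in> S \<Longrightarrow> r \<cdot>\<^sub>v x \<in> S"
    and mod_t: "\<And>x. x \<in> carrier_vec N \<Longrightarrow> \<exists>s\<in>S. \<exists>y\<in>carrier_vec N. x = s + t \<cdot>\<^sub>v y"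
    and power: "\<And>x. x \<in> carrier_vec N \<Longrightarrow> t ^ e \<cdot>\<^sub>v x \<in> S"
  shows "carrier_vec N \<subseteq> S"
proof -
  have "\<forall>x\<in>carrier_vec N. t ^ k \<cdot>\<^sub>v x \<in> S" if "k \<le> e" for k
    using that
  proof (induction k rule: inc_induct)
    case base
    then show ?case using power by blast
  next
    case (step k)
    show ?case
    proof
      fix x :: "'a vec" assume x: "x \<in> carrier_vec N"
      obtain s y where s: "s \<in> S" and y: "y \<in> carrier_vec N" and xsy: "x = s + t \<cdot>\<^sub>v y"
        using mod_t[OF x] by blast
      have "t ^ k \<cdot>\<^sub>v x = t ^ k \<cdot>\<^sub>v s + t ^ Suc k \<cdot>\<^sub>v y"
        unfolding xsy using s S y by (intro eq_vecI) (auto simp: algebra_simps)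
      then show "t ^ k \<cdot>\<^sub>v x \<in> S" using add smult s y step.IH by simp
    qed
  qed
  then show ?thesis by force
qed


lemma is_rep_carrier:
  assumes "is_rep n a b" "j = i + 1"
  shows "a i \<in> carrier_mat (n j) (n i)" and "b i \<in> carrier_mat (n i) (n j)"
  using assms by (auto simp: is_rep_def)

lemma upcomp_carrier:
  assumes rep: "is_rep n a b"
  shows "upcomp n a i k \<in> carrier_mat (n (i + int k)) (n i)"
proof (induction k)
  case (Suc k)
  have "a (i + int k) \<in> carrier_mat (n (i + int (Suc k))) (n (i + int k))"
    by (rule is_rep_carrier(1)[OF rep]) simp
  then show ?case by (simp only: upcomp.simps) (rule mult_carrier_mat[OF _ Suc.IH])
qed simp

lemma upcomp_Suc_right:
  assumes rep: "is_rep n a b"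
  shows "upcomp n a i (Suc k) = upcomp n a (i+1) k * a i"
proof (induction k)
  case 0
  have "a i \<in> carrier_mat (n (i+1)) (n i)" by (rule is_rep_carrier(1)[OF rep]) simp
  then show ?case by simp
next
  case (Suc k)
  have idx: "i + int (Suc k) = (i+1) + int k" by simp
  have ai: "a i \<in> carrier_mat (n (i+1)) (n i)" by (rule is_rep_carrier(1)[OF rep]) simp
  have a: "a ((i+1) + int k) \<in> carrier_mat (n ((i+1) + int (Suc k))) (n ((i+1) + int k))"
    by (rule is_rep_carrier(1)[OF rep]) simp
  have "upcomp n a i (Suc (Suc k)) = a ((i+1) + int k) * (upcomp n a (i+1) k * a i)"
    by (simp only: upcomp.simps(2)[of n a i "Suc k"] idx Suc.IH)
  also have "\<dots> = upcomp n a (i+1) (Suc k) * a i"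
    using a upcomp_carrier[OF rep, of "i+1" k] ai by (simp add: assoc_mult_mat)
  finally show ?case .
qed

lemma downcomp_carrier:
  assumes rep: "is_rep n a b"
  shows "downcomp n b i k \<in> carrier_mat (n (i - int k)) (n i)"
proof (induction k)
  case (Suc k)
  have idx: "i - int (Suc k) = i - int k - 1" by simp
  have "b (i - int k - 1) \<in> carrier_mat (n (i - int k - 1)) (n (i - int k))"
    by (rule is_rep_carrier(2)[OF rep]) simp
  then show ?case unfolding idx by (simp only: downcomp.simps) (rule mult_carrier_mat[OF _ Suc.IH])
qed simp

lemma downcomp_Suc_right:
  assumes rep: "is_rep n a b"
  shows "downcomp n b i (Suc k) = downcomp n b (i-1) k * b (i-1)"
proof (induction k)
  case 0
  have "b (i-1) \<in> carrier_mat (n (i-1)) (n i)" by (rule is_rep_carrier(2)[OF rep]) simp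
  then show ?case by simp
next
  case (Suc k)
  have idx: "i - int (Suc k) - 1 = (i-1) - int k - 1" by simp
  have bi: "b (i-1) \<in> carrier_mat (n (i-1)) (n i)" by (rule is_rep_carrier(2)[OF rep]) simp
  have b: "b ((i-1) - int k - 1) \<in> carrier_mat (n ((i-1) - int k - 1)) (n ((i-1) - int k))"
    by (rule is_rep_carrier(2)[OF rep]) simp
  have "downcomp n b i (Suc (Suc k)) = b ((i-1) - int k - 1) * (downcomp n b (i-1) k * b (i-1))"
    by (simp only: downcomp.simps(2)[of n b i "Suc k"] idx Suc.IH)
  also have "\<dots> = downcomp n b (i-1) (Suc k) * b (i-1)"
    using b downcomp_carrier[OF rep, of "i-1" k] bi by (simp add: assoc_mult_mat)
  finally show ?case .
qed

lemma inj_on_mult_mat_vec_right_factor: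
  assumes "P \<in> carrier_mat a b" "Q \<in> carrier_mat b c" "inj_on ((*\<^sub>v) (P * Q)) (carrier_vec c)"
  shows "inj_on ((*\<^sub>v) Q) (carrier_vec c)"
  using assms by (auto simp: inj_on_def)

lemma finite_cosupport_bounds:
  fixes a b :: "int \<Rightarrow> 'k::field mat"
  assumes rep: "is_rep n a b" and H: "finite_cosupport n a b H"
  shows "\<exists>m M. m \<le> M \<and> (\<forall>i<m. inj_on ((*\<^sub>v) (a i)) (carrier_vec (n i))) \<and>
           (\<forall>i\<ge>M. inj_on ((*\<^sub>v) (b i)) (carrier_vec (n (i+1))))"
proof (intro exI conjI allI impI)
  have fin: "finite H" and inj: "\<And>i. \<exists>j\<in>H. inj_on ((*\<^sub>v) (comp_map n a b i j)) (carrier_vec (n i))"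
    using H by (auto simp: finite_cosupport_def)
  then have ne: "H \<noteq> {}" by blast
  show "Min H \<le> Max H" using fin ne by simp
  show "inj_on ((*\<^sub>v) (a i)) (carrier_vec (n i))" if "i < Min H" for i
  proof -
    obtain j where j: "j \<in> H" "inj_on ((*\<^sub>v) (comp_map n a b i j)) (carrier_vec (n i))" using inj by blast
    have "i < j" using that Min_le[OF fin j(1)] by simp
    then obtain k where "nat (j - i) = Suc k" by (metis gr0_implies_Suc zero_less_nat_eq diff_gt_0_iff_gt)
    then have "comp_map n a b i j = upcomp n a (i+1) k * a i"
      using \<open>i < j\<close> by (simp add: comp_map_def upcomp_Suc_right[OF rep] del: upcomp.simps(2))
    moreover have "a i \<in> carrier_mat (n (i+1)) (n i)" using rep by (simp add: is_rep_def)
    ultimately show ?thesis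
      using j(2) inj_on_mult_mat_vec_right_factor upcomp_carrier[OF rep, of "i+1" k] by metis
  qed
  show "inj_on ((*\<^sub>v) (b i)) (carrier_vec (n (i+1)))" if "Max H \<le> i" for i
  proof -
    obtain j where j: "j \<in> H" "inj_on ((*\<^sub>v) (comp_map n a b (i+1) j)) (carrier_vec (n (i+1)))" using inj by blast
    have "j < i + 1" using that Max_ge[OF fin j(1)] by simp
    then obtain k where "nat (i + 1 - j) = Suc k" by (metis gr0_implies_Suc zero_less_nat_eq diff_gt_0_iff_gt)
    then have "comp_map n a b (i+1) j = downcomp n b i k * b i"
      using \<open>j < i + 1\<close> by (simp add: comp_map_def downcomp_Suc_right[OF rep] del: downcomp.simps(2))
    moreover have "b i \<in> carrier_mat (n i) (n (i+1))" using rep by (simp add: is_rep_def)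
    ultimately show ?thesis
      using j(2) inj_on_mult_mat_vec_right_factor downcomp_carrier[OF rep, of i k] by metis
  qed
qed

lemma int_seq_down_choice:
  fixes m :: int
  assumes start: "P m v" and step: "\<And>i v. i < m \<Longrightarrow> P (i+1) v \<Longrightarrow> \<exists>u. P i u \<and> R i u v"
  shows "\<exists>x. x m = v \<and> (\<forall>i\<le>m. P i (x i)) \<and> (\<forall>i<m. R i (x i) (x (i+1)))"
proof -
  obtain f where f: "\<And>i v. i < m \<Longrightarrow> P (i+1) v \<Longrightarrow> P i (f i v) \<and> R i (f i v) v"
    using step by metis
  define y where "y = rec_nat v (\<lambda>k u. f (m - int k - 1) u)"
  have y0: "y 0 = v" and ySuc: "y (Suc k) = f (m - int k - 1) (y k)" for k by (simp_all add: y_def)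
  have Py: "P (m - int k) (y k)" for k
  proof (induction k)
    case (Suc k)
    then show ?case using f[of "m - int k - 1" "y k"] by (simp add: ySuc algebra_simps)
  qed (simp add: y0 start)
  have Ry: "R (m - int k - 1) (y (Suc k)) (y k)" for k
    using f[of "m - int k - 1" "y k"] Py[of k] by (simp add: ySuc)
  define x where "x i = y (nat (m - i))" for i
  have "R i (x i) (x (i+1))" if "i < m" for i
    using Ry[of "nat (m - i - 1)"] that unfolding x_def by (simp add: Suc_nat_eq_nat_zadd1 algebra_simps)
  moreover have "P i (x i)" if "i \<le> m" for i using Py[of "nat (m - i)"] that by (simp add: x_def)
  moreover have "x m = v" by (simp add: x_def y0)
  ultimately show ?thesis by (intro exI[of _ x]) auto
qed

lemma int_seq_choice:
  fixes m M :: int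
  assumes "m \<le> M"
    and mid: "\<exists>x. \<forall>i. m \<le> i \<and> i \<le> M \<longrightarrow> P i (x i) \<and> (i < M \<longrightarrow> R i (x i) (x (i+1)))"
    and down: "\<And>i v. i < m \<Longrightarrow> P (i+1) v \<Longrightarrow> \<exists>u. P i u \<and> R i u v"
    and up: "\<And>i v. M \<le> i \<Longrightarrow> P i v \<Longrightarrow> \<exists>u. P (i+1) u \<and> R i v u"
  shows "\<exists>x. \<forall>i. P i (x i) \<and> R i (x i) (x (i+1))"
proof -
  obtain f where f_mid: "\<forall>i. m \<le> i \<and> i \<le> M \<longrightarrow> P i (f i) \<and> (i < M \<longrightarrow> R i (f i) (f (i+1)))"
    using mid by blast
  then have f: "\<And>i. m \<le> i \<Longrightarrow> i \<le> M \<Longrightarrow> P i (f i)"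
    and f_step: "\<And>i. m \<le> i \<Longrightarrow> i < M \<Longrightarrow> R i (f i) (f (i+1))" by auto
  obtain l where l: "l m = f m" "\<And>i. i \<le> m \<Longrightarrow> P i (l i)" "\<And>i. i < m \<Longrightarrow> R i (l i) (l (i+1))"
    using int_seq_down_choice[of P m "f m" R] f[of m] down \<open>m \<le> M\<close> by auto
  \<comment> \<open>the right half comes from int_seq_down_choice under the reflection i to -i\<close>
  have up': "\<exists>u. P (- i) u \<and> R (- i - 1) v u" if "i < - M" "P (- (i+1)) v" for i v
    using up[of "- i - 1" v] that by simp
  obtain r where r: "r (- M) = f M" "\<And>i. i \<le> - M \<Longrightarrow> P (- i) (r i)"
      "\<And>i. i < - M \<Longrightarrow> R (- i - 1) (r (i+1)) (r i)"
    using int_seq_down_choice[of "\<lambda>i. P (- i)" "- M" "f M" "\<lambda>i u v. R (- i - 1) v u", OF _ up']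
      f[of M] \<open>m \<le> M\<close> by auto
  define x where "x i = (if i < m then l i else if i \<le> M then f i else r (- i))" for i
  have xl: "x i = l i" if "i \<le> m" for i using that l(1) \<open>m \<le> M\<close> by (simp add: x_def)
  have xf: "x i = f i" if "m \<le> i" "i \<le> M" for i using that by (simp add: x_def)
  have xr: "x i = r (- i)" if "M \<le> i" for i using that r(1) \<open>m \<le> M\<close> by (simp add: x_def)
  have "P i (x i) \<and> R i (x i) (x (i+1))" for i
  proof -
    consider "i < m" | "m \<le> i" "i < M" | "M \<le> i" by linarith
    then show ?thesis
    proof cases
      case 1
      then show ?thesis using l(2,3) xl[of i] xl[of "i+1"] by simp
    next
      case 2
      then show ?thesis using f f_step xf[of i] xf[of "i+1"] by simp
    next
      case 3
      then show ?thesis using r(2)[of "- i"] r(3)[of "- i - 1"] xr[of i] xr[of "i+1"] by simp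
    qed
  qed
  then show ?thesis by blast
qed

locale dvr_residue = ring_hom p for p :: "'r::idom \<Rightarrow> 'k::field" +
  fixes t :: 'r
  assumes uniformizer_nonzero: "t \<noteq> 0"
    and uniformizer_not_unit: "\<not> t dvd 1"
    and unit_mult_uniformizer_power: "x \<noteq> 0 \<Longrightarrow> \<exists>u m. u dvd 1 \<and> x = u * t ^ m"
    and residue_surj: "surj p"
    and residue_eq_0_iff: "p x = 0 \<longleftrightarrow> \<not> x dvd 1"
begin

lemma residue_eq_0_iff_dvd: "p x = 0 \<longleftrightarrow> t dvd x"
proof
  assume px: "p x = 0"
  show "t dvd x"
  proof (cases "x = 0")
    case False
    then obtain u m where u: "u dvd 1" and x: "x = u * t ^ m"
      using unit_mult_uniformizer_power by blast
    have "m \<noteq> 0"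
    proof
      assume "m = 0"
      then have "x dvd 1" using u x by simp
      then show False using px residue_eq_0_iff by simp
    qed
    then show ?thesis by (simp add: x dvd_mult dvd_power)
  qed simp
next
  assume "t dvd x"
  then show "p x = 0" using uniformizer_not_unit residue_eq_0_iff by (meson dvd_trans)
qed

lemma residue_uniformizer [simp]: "p t = 0"
  by (simp add: residue_eq_0_iff_dvd)

lemma dvd_uniformizer_power:
  assumes "c \<noteq> 0"
  shows "\<exists>e. c dvd t ^ e"
proof -
  obtain u m where "u dvd 1" "c = u * t ^ m" using unit_mult_uniformizer_power[OF assms] by blast
  then have "c dvd t ^ m" by (simp add: mult_unit_dvd_iff')
  then show ?thesis ..
qed

lemma exists_lift_vec: "y \<in> carrier_vec N \<Longrightarrow> \<exists>Y\<in>carrier_vec N. map_vec p Y = y"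
proof -
  assume y: "y \<in> carrier_vec N"
  have "\<forall>l. \<exists>r. p r = y $ l" using residue_surj by (metis surjD)
  then obtain f where "\<And>l. p (f l) = y $ l" by metis
  then have "map_vec p (vec N f) = y" using y by (intro eq_vecI) auto
  then show ?thesis by auto
qed

lemma vec_eq_mod_uniformizer:
  assumes v: "v \<in> carrier_vec N" and w: "w \<in> carrier_vec N" and vw: "map_vec p v = map_vec p w"
  shows "\<exists>d\<in>carrier_vec N. v = w + t \<cdot>\<^sub>v d"
proof -
  have "t dvd v $ l - w $ l" if "l < N" for l
    using arg_cong[OF vw, of "\<lambda>u. u $ l"] that v w by (simp add: residue_eq_0_iff_dvd[symmetric] hom_distribs)
  then have "\<forall>l. \<exists>r. l < N \<longrightarrow> v $ l - w $ l = t * r" by (meson dvdE)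
  then obtain f where "\<And>l. l < N \<Longrightarrow> v $ l - w $ l = t * f l" by metis
  then have "v = w + t \<cdot>\<^sub>v vec N f" using v w by (intro eq_vecI) (auto simp: algebra_simps)
  then show ?thesis by auto
qed

lemma map_vec_add_smult_residue_zero:
  "p c = 0 \<Longrightarrow> v \<in> carrier_vec N \<Longrightarrow> d \<in> carrier_vec N \<Longrightarrow> map_vec p (v + c \<cdot>\<^sub>v d) = map_vec p v"
  by (intro eq_vecI) (auto simp: hom_distribs)

lemma divisible_of_residue_injective:
  assumes M: "M \<in> carrier_mat a b" and inj: "inj_on ((*\<^sub>v) (map_mat p M)) (carrier_vec b)"
  shows "y \<in> carrier_vec b \<Longrightarrow> w \<in> carrier_vec a \<Longrightarrow> M *\<^sub>v y = t ^ e \<cdot>\<^sub>v w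
    \<Longrightarrow> \<exists>y'\<in>carrier_vec b. y = t ^ e \<cdot>\<^sub>v y'"
proof (induction e arbitrary: y w)
  case 0
  then show ?case by auto
next
  case (Suc e)
  have "map_mat p M *\<^sub>v map_vec p y = map_vec p (M *\<^sub>v y)"
    by (rule mult_mat_vec_hom[symmetric, OF M Suc.prems(1)])
  also have "\<dots> = 0\<^sub>v a"
    unfolding Suc.prems(3) using Suc.prems(2) by (intro eq_vecI) (auto simp: hom_distribs)
  also have "\<dots> = map_mat p M *\<^sub>v map_vec p (0\<^sub>v b)"
    using M by (simp add: vec_hom_zero mult_mat_vec_zero)
  finally have "map_vec p y = map_vec p (0\<^sub>v b)"
    using inj Suc.prems(1) by (auto dest: inj_onD)
  then obtain y1 where y1: "y1 \<in> carrier_vec b" "y = t \<cdot>\<^sub>v y1"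
    using vec_eq_mod_uniformizer[of y b "0\<^sub>v b"] Suc.prems(1) by auto
  have eq: "t \<cdot>\<^sub>v (M *\<^sub>v y1) = t \<cdot>\<^sub>v (t ^ e \<cdot>\<^sub>v w)"
    using Suc.prems(3) M y1 by (simp add: mult_mat_vec_smult smult_smult_assoc)
  have "M *\<^sub>v y1 = t ^ e \<cdot>\<^sub>v w"
    by (rule smult_vec_left_cancel[OF uniformizer_nonzero _ _ eq]) (use M y1(1) Suc.prems(2) in auto)
  then obtain y2 where "y2 \<in> carrier_vec b" "y1 = t ^ e \<cdot>\<^sub>v y2"
    using Suc.IH[OF y1(1) Suc.prems(2)] by blast
  then show ?case using y1(2) by (auto simp: smult_smult_assoc)
qed

lemma exists_preimage_of_residue_injective:
  assumes M: "M \<in> carrier_mat a b" and N: "N \<in> carrier_mat b a"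
    and MN: "M * N = d \<cdot>\<^sub>m 1\<^sub>m a" "d \<noteq> 0"
    and inj: "inj_on ((*\<^sub>v) (map_mat p M)) (carrier_vec b)"
    and v: "v \<in> carrier_vec a"
  shows "\<exists>u\<in>carrier_vec b. M *\<^sub>v u = v"
proof -
  obtain e c where tc: "t ^ e = d * c" using dvd_uniformizer_power[OF MN(2)] by (auto elim: dvdE)
  have "M *\<^sub>v (N *\<^sub>v (c \<cdot>\<^sub>v v)) = (M * N) *\<^sub>v (c \<cdot>\<^sub>v v)" using M N v by simp
  also have "\<dots> = t ^ e \<cdot>\<^sub>v v" using v by (simp add: MN smult_one_mat_mult_vec smult_smult_assoc tc)
  finally have MNv: "M *\<^sub>v (N *\<^sub>v (c \<cdot>\<^sub>v v)) = t ^ e \<cdot>\<^sub>v v" .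
  \<comment> \<open>so N (c v) is a preimage of t^e v, and injectivity mod t lets one divide it by t^e\<close>
  then obtain y where y: "y \<in> carrier_vec b" "N *\<^sub>v (c \<cdot>\<^sub>v v) = t ^ e \<cdot>\<^sub>v y"
    using divisible_of_residue_injective[OF M inj, of "N *\<^sub>v (c \<cdot>\<^sub>v v)" v e] N v by auto
  have eq: "t ^ e \<cdot>\<^sub>v (M *\<^sub>v y) = t ^ e \<cdot>\<^sub>v v"
    using MNv M y by (simp add: mult_mat_vec_smult)
  have "M *\<^sub>v y = v"
    by (rule smult_vec_left_cancel[of "t ^ e", OF _ _ _ eq]) (use uniformizer_nonzero M y(1) v in auto)
  then show ?thesis using y(1) by blast
qed

lemma exists_line_preimage_of_residue_injective:
  assumes M: "M \<in> carrier_mat a b" and N: "N \<in> carrier_mat b a"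
    and MN: "M * N = d \<cdot>\<^sub>m 1\<^sub>m a" "d \<noteq> 0"
    and inj: "inj_on ((*\<^sub>v) (map_mat p M)) (carrier_vec b)"
    and v: "v \<in> carrier_vec a"
    and w: "w \<in> carrier_vec b" "w \<noteq> 0\<^sub>v b" "map_mat p M *\<^sub>v w \<in> multiples (map_vec p v)"
  shows "\<exists>u\<in>carrier_vec b. M *\<^sub>v u = v \<and> multiples w = multiples (map_vec p u)"
proof -
  obtain u where u: "u \<in> carrier_vec b" "M *\<^sub>v u = v"
    using exists_preimage_of_residue_injective[OF M N MN inj v] by blast
  have "map_vec p v = map_mat p M *\<^sub>v map_vec p u" using u M by (auto simp: mult_mat_vec_hom)
  then have "multiples w = multiples (map_vec p u)"
    using multiples_eq_of_injective[OF _ inj w(1,2)] M u(1) w(3) by simp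
  then show ?thesis using u by blast
qed

end

locale smoothed_chain = dvr_residue p t for p :: "'r::idom \<Rightarrow> 'k::field" and t :: 'r +
  fixes n :: "int \<Rightarrow> nat" and A B :: "int \<Rightarrow> 'r mat"
  assumes rep: "is_rep n A B"
    and BA_scalar: "\<exists>c. c \<noteq> 0 \<and> B i * A i = c \<cdot>\<^sub>m 1\<^sub>m (n i)"
    and AB_scalar: "\<exists>d. d \<noteq> 0 \<and> A i * B i = d \<cdot>\<^sub>m 1\<^sub>m (n (i+1))"
    and colinked: "colinked_chain n (\<lambda>i. map_mat p (A i)) (\<lambda>i. map_mat p (B i))"
begin

lemma A_carrier: "A i \<in> carrier_mat (n (i+1)) (n i)"
  and B_carrier: "B i \<in> carrier_mat (n i) (n (i+1))"
  using rep by (auto simp: is_rep_def)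

lemma residue_images_span:
  "w \<in> carrier_vec (n i) \<Longrightarrow> \<exists>y\<in>carrier_vec (n (i+1)). \<exists>z\<in>carrier_vec (n (i-1)).
     w = map_mat p (B i) *\<^sub>v y + map_mat p (A (i-1)) *\<^sub>v z"
  using colinked by (auto simp: colinked_chain_def)

lemma A_mult_B_divisible:
  assumes z: "z \<in> carrier_vec (n (i+1))"
  shows "\<exists>z'\<in>carrier_vec (n (i+1)). A i *\<^sub>v (B i *\<^sub>v z) = t \<cdot>\<^sub>v z'"
proof -
  have AB: "A i \<in> carrier_mat (n (i+1)) (n i)" "B i \<in> carrier_mat (n i) (n (i+1))"
    by (rule A_carrier B_carrier)+
  have "map_vec p (A i *\<^sub>v (B i *\<^sub>v z)) = (map_mat p (A i) * map_mat p (B i)) *\<^sub>v map_vec p z"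
    using AB z by (simp add: mult_mat_vec_hom)
  also have "\<dots> = map_vec p (0\<^sub>v (n (i+1)))"
    using colinked z by (auto simp: colinked_chain_def vec_hom_zero)
  finally have "map_vec p (A i *\<^sub>v (B i *\<^sub>v z)) = map_vec p (0\<^sub>v (n (i+1)))" .
  then obtain d where "d \<in> carrier_vec (n (i+1))" "A i *\<^sub>v (B i *\<^sub>v z) = 0\<^sub>v (n (i+1)) + t \<cdot>\<^sub>v d"
    using vec_eq_mod_uniformizer[OF _ zero_carrier_vec] AB z by (meson mult_mat_vec_carrier)
  then show ?thesis by auto
qed

definition linked :: "(int \<Rightarrow> bool) \<Rightarrow> int \<Rightarrow> 'r vec \<Rightarrow> 'r vec \<Rightarrow> bool" where
  "linked fwd i u v \<longleftrightarrow> (if fwd i then A i *\<^sub>v u = v else B i *\<^sub>v v = u)"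

definition zigzag :: "(int \<Rightarrow> bool) \<Rightarrow> int \<Rightarrow> int \<Rightarrow> (int \<Rightarrow> 'r vec) \<Rightarrow> bool" where
  "zigzag fwd m j x \<longleftrightarrow> (\<forall>i. m \<le> i \<and> i \<le> j \<longrightarrow> x i \<in> carrier_vec (n i)) \<and>
     (\<forall>i. m \<le> i \<and> i < j \<longrightarrow> linked fwd i (x i) (x (i+1)))"

lemma linked_add:
  assumes "linked fwd i u v" "linked fwd i u' v'"
    and "u \<in> carrier_vec (n i)" "u' \<in> carrier_vec (n i)" "v \<in> carrier_vec (n (i+1))" "v' \<in> carrier_vec (n (i+1))"
  shows "linked fwd i (u + u') (v + v')"
  using assms A_carrier[of i] B_carrier[of i] by (auto simp: linked_def mult_add_distrib_mat_vec split: if_splits)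

lemma linked_smult:
  assumes "linked fwd i u v" "u \<in> carrier_vec (n i)" "v \<in> carrier_vec (n (i+1))"
  shows "linked fwd i (a \<cdot>\<^sub>v u) (a \<cdot>\<^sub>v v)"
  using assms A_carrier[of i] B_carrier[of i] by (auto simp: linked_def mult_mat_vec_smult split: if_splits)

lemma zigzag_carrier: "zigzag fwd m j x \<Longrightarrow> m \<le> i \<Longrightarrow> i \<le> j \<Longrightarrow> x i \<in> carrier_vec (n i)"
  by (simp add: zigzag_def)

lemma zigzag_add: "zigzag fwd m j x \<Longrightarrow> zigzag fwd m j y \<Longrightarrow> zigzag fwd m j (\<lambda>i. x i + y i)"
  by (auto simp: zigzag_def intro!: linked_add)

lemma zigzag_smult: "zigzag fwd m j x \<Longrightarrow> zigzag fwd m j (\<lambda>i. a \<cdot>\<^sub>v x i)"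
  by (auto simp: zigzag_def intro!: linked_smult)

lemma zigzag_zero: "zigzag fwd m j (\<lambda>i. 0\<^sub>v (n i))"
  using A_carrier B_carrier by (auto simp: zigzag_def linked_def mult_mat_vec_zero)

lemma zigzag_single: "w \<in> carrier_vec (n m) \<Longrightarrow> zigzag fwd m m (\<lambda>_. w)"
  by (auto simp: zigzag_def)

lemma zigzag_extend:
  assumes "zigzag fwd m i x" "m \<le> i" "v \<in> carrier_vec (n (i+1))" "linked fwd i (x i) v"
  shows "zigzag fwd m (i+1) (x(i+1 := v))"
  using assms by (auto simp: zigzag_def)

lemma zigzag_extend_by_A:
  assumes x: "zigzag fwd m i x" and i: "m \<le> i"
  shows "\<exists>y. zigzag fwd m (i+1) y \<and> y (i+1) = A i *\<^sub>v x i"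
proof (cases "fwd i")
  case True
  then have "linked fwd i (x i) (A i *\<^sub>v x i)" by (simp add: linked_def)
  then have "zigzag fwd m (i+1) (x(i+1 := A i *\<^sub>v x i))"
    using zigzag_extend[OF x i] zigzag_carrier[OF x i] A_carrier[of i] by simp
  then show ?thesis by (intro exI[of _ "x(i+1 := A i *\<^sub>v x i)"]) simp
next
  case False
  obtain c where c: "B i * A i = c \<cdot>\<^sub>m 1\<^sub>m (n i)" using BA_scalar by blast
  have xi: "x i \<in> carrier_vec (n i)" using zigzag_carrier[OF x i] by simp
  have "B i *\<^sub>v (A i *\<^sub>v x i) = c \<cdot>\<^sub>v x i"
    using A_carrier[of i] B_carrier[of i] xi
    by (simp add: c smult_one_mat_mult_vec flip: assoc_mult_mat_vec[of _ _ "n (i+1)"])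
  then have "linked fwd i (c \<cdot>\<^sub>v x i) (A i *\<^sub>v x i)" using False by (simp add: linked_def)
  then have "zigzag fwd m (i+1) ((\<lambda>k. c \<cdot>\<^sub>v x k)(i+1 := A i *\<^sub>v x i))"
    using zigzag_extend[OF zigzag_smult[OF x] i] A_carrier[of i] xi by simp
  then show ?thesis by (intro exI[of _ "(\<lambda>k. c \<cdot>\<^sub>v x k)(i+1 := A i *\<^sub>v x i)"]) simp
qed

definition end_span :: "(int \<Rightarrow> bool) \<Rightarrow> int \<Rightarrow> int \<Rightarrow> 'r vec set" where
  "end_span fwd m j = {x j + B j *\<^sub>v z | x z. zigzag fwd m j x \<and> z \<in> carrier_vec (n (j+1))}"

lemma end_span_intro:
  "zigzag fwd m j x \<Longrightarrow> z \<in> carrier_vec (n (j+1)) \<Longrightarrow> x j + B j *\<^sub>v z \<in> end_span fwd m j"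
  unfolding end_span_def by blast

lemma end_span_carrier: "m \<le> j \<Longrightarrow> end_span fwd m j \<subseteq> carrier_vec (n j)"
  using B_carrier[of j] zigzag_carrier[of fwd m j _ j] by (auto simp: end_span_def)

lemma end_span_add:
  assumes j: "m \<le> j" and "u \<in> end_span fwd m j" "v \<in> end_span fwd m j"
  shows "u + v \<in> end_span fwd m j"
proof -
  obtain x z y z' where x: "zigzag fwd m j x" "z \<in> carrier_vec (n (j+1))" "u = x j + B j *\<^sub>v z"
    and y: "zigzag fwd m j y" "z' \<in> carrier_vec (n (j+1))" "v = y j + B j *\<^sub>v z'"
    using assms(2,3) by (auto simp: end_span_def)
  have "u + v = (x j + y j) + B j *\<^sub>v (z + z')"
    using zigzag_carrier[OF x(1) j] zigzag_carrier[OF y(1) j] B_carrier[of j] x y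
    by (intro eq_vecI) (auto simp: mult_add_distrib_mat_vec)
  then show ?thesis
    using end_span_intro[OF zigzag_add[OF x(1) y(1)], of "z + z'"] x(2) y(2) by simp
qed

lemma end_span_smult:
  assumes j: "m \<le> j" and "u \<in> end_span fwd m j"
  shows "a \<cdot>\<^sub>v u \<in> end_span fwd m j"
proof -
  obtain x z where x: "zigzag fwd m j x" "z \<in> carrier_vec (n (j+1))" "u = x j + B j *\<^sub>v z"
    using assms(2) by (auto simp: end_span_def)
  have "a \<cdot>\<^sub>v u = a \<cdot>\<^sub>v x j + B j *\<^sub>v (a \<cdot>\<^sub>v z)"
    using zigzag_carrier[OF x(1) j] B_carrier[of j] x
    by (simp add: mult_mat_vec_smult smult_add_distrib_vec[of _ "n j"])
  then show ?thesis
    using end_span_intro[OF zigzag_smult[OF x(1)], of "a \<cdot>\<^sub>v z"] x(2) by simp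
qed

lemma end_span_uniformizer_power:
  "\<exists>e. \<forall>w\<in>carrier_vec (n j). t ^ e \<cdot>\<^sub>v w \<in> end_span fwd m j"
proof -
  obtain c where c: "c \<noteq> 0" "B j * A j = c \<cdot>\<^sub>m 1\<^sub>m (n j)" using BA_scalar by blast
  obtain e u where tcu: "t ^ e = c * u" using dvd_uniformizer_power[OF c(1)] by (auto elim: dvdE)
  have "t ^ e \<cdot>\<^sub>v w \<in> end_span fwd m j" if w: "w \<in> carrier_vec (n j)" for w
  proof -
    have "t ^ e \<cdot>\<^sub>v w = 0\<^sub>v (n j) + B j *\<^sub>v (A j *\<^sub>v (u \<cdot>\<^sub>v w))"
      using A_carrier[of j] B_carrier[of j] w
      by (simp add: c smult_one_mat_mult_vec smult_smult_assoc tcu flip: assoc_mult_mat_vec[of _ _ "n (j+1)"])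
    then show ?thesis
      using end_span_intro[OF zigzag_zero, of "A j *\<^sub>v (u \<cdot>\<^sub>v w)"] A_carrier[of j] w by simp
  qed
  then show ?thesis by blast
qed

lemma A_end_span_mod_uniformizer:
  assumes j: "m \<le> j" and Z: "Z \<in> end_span fwd m j"
  shows "\<exists>x. zigzag fwd m (j+1) x \<and> (\<exists>z\<in>carrier_vec (n (j+1)). A j *\<^sub>v Z = x (j+1) + t \<cdot>\<^sub>v z)"
proof -
  obtain x z where x: "zigzag fwd m j x" and z: "z \<in> carrier_vec (n (j+1))" and Zx: "Z = x j + B j *\<^sub>v z"
    using Z unfolding end_span_def by blast
  obtain x' where x': "zigzag fwd m (j+1) x'" "x' (j+1) = A j *\<^sub>v x j"
    using zigzag_extend_by_A[OF x j] by blast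
  obtain z' where z': "z' \<in> carrier_vec (n (j+1))" "A j *\<^sub>v (B j *\<^sub>v z) = t \<cdot>\<^sub>v z'"
    using A_mult_B_divisible[OF z] by blast
  have "A j *\<^sub>v Z = x' (j+1) + t \<cdot>\<^sub>v z'"
    unfolding Zx x'(2) z'(2)[symmetric] using A_carrier[of j] B_carrier[of j] zigzag_carrier[OF x j] z
    by (simp add: mult_add_distrib_mat_vec)
  then show ?thesis using x'(1) z'(1) by blast
qed

lemma end_span_mod_uniformizer:
  assumes j: "m \<le> j" and prev: "carrier_vec (n j) \<subseteq> end_span fwd m j"
    and w: "w \<in> carrier_vec (n (j+1))"
  shows "\<exists>s\<in>end_span fwd m (j+1). \<exists>y\<in>carrier_vec (n (j+1)). w = s + t \<cdot>\<^sub>v y"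
proof -
  have "map_vec p w \<in> carrier_vec (n (j+1))" using w by simp
  from residue_images_span[OF this] obtain y z where y: "y \<in> carrier_vec (n (j+1+1))"
    and z: "z \<in> carrier_vec (n j)" and wyz: "map_vec p w = map_mat p (B (j+1)) *\<^sub>v y + map_mat p (A j) *\<^sub>v z"
    by (metis add_diff_cancel_right')
  obtain Y where Y: "Y \<in> carrier_vec (n (j+1+1))" "map_vec p Y = y" using exists_lift_vec[OF y] by blast
  obtain Z where Z: "Z \<in> carrier_vec (n j)" "map_vec p Z = z" using exists_lift_vec[OF z] by blast
  have BY: "B (j+1) *\<^sub>v Y \<in> carrier_vec (n (j+1))" and AZ: "A j *\<^sub>v Z \<in> carrier_vec (n (j+1))"
    using A_carrier[of j] B_carrier[of "j+1"] Y Z by auto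
  have "map_vec p w = map_vec p (B (j+1) *\<^sub>v Y + A j *\<^sub>v Z)"
    unfolding wyz vec_hom_add[OF BY AZ] mult_mat_vec_hom[OF B_carrier Y(1)] mult_mat_vec_hom[OF A_carrier Z(1)]
    Y(2) Z(2) ..
  then obtain d where d: "d \<in> carrier_vec (n (j+1))" "w = (B (j+1) *\<^sub>v Y + A j *\<^sub>v Z) + t \<cdot>\<^sub>v d"
    using vec_eq_mod_uniformizer[OF w add_carrier_vec[OF BY AZ]] by blast
  obtain x z' where x: "zigzag fwd m (j+1) x" and z': "z' \<in> carrier_vec (n (j+1))"
    and AZ_eq: "A j *\<^sub>v Z = x (j+1) + t \<cdot>\<^sub>v z'"
    using A_end_span_mod_uniformizer[OF j] prev Z(1) by blast
  have xj: "x (j+1) \<in> carrier_vec (n (j+1))" using zigzag_carrier[OF x] j by simp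
  have rearrange: "(a + (b + t \<cdot>\<^sub>v c)) + t \<cdot>\<^sub>v e = (b + a) + t \<cdot>\<^sub>v (c + e)"
    if "a \<in> carrier_vec N" "b \<in> carrier_vec N" "c \<in> carrier_vec N" "e \<in> carrier_vec N" for a b c e :: "'r vec" and N
    using that by (intro eq_vecI) (auto simp: distrib_left ac_simps)
  have "w = (x (j+1) + B (j+1) *\<^sub>v Y) + t \<cdot>\<^sub>v (z' + d)"
    using d(2) unfolding AZ_eq by (simp only: rearrange[OF BY xj z' d(1)])
  then show ?thesis
    using end_span_intro[OF x Y(1)] add_carrier_vec[OF z' d(1)] by (intro bexI) auto
qed

lemma carrier_subset_end_span: "m \<le> j \<Longrightarrow> carrier_vec (n j) \<subseteq> end_span fwd m j"
proof (induction j rule: int_ge_induct)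
  case base
  have "w \<in> end_span fwd m m" if "w \<in> carrier_vec (n m)" for w
    using end_span_intro[OF zigzag_single[OF that, where fwd = fwd] zero_carrier_vec] that B_carrier[of m]
    by (simp add: mult_mat_vec_zero)
  then show ?case by blast
next
  case (step j)
  have j: "m \<le> j + 1" using step.hyps by simp
  obtain e where power: "\<And>w. w \<in> carrier_vec (n (j+1)) \<Longrightarrow> t ^ e \<cdot>\<^sub>v w \<in> end_span fwd m (j+1)"
    using end_span_uniformizer_power by blast
  show ?case
    by (rule carrier_vec_subset_nakayama[OF end_span_carrier[OF j] end_span_add[OF j] end_span_smult[OF j]
          end_span_mod_uniformizer[OF step.hyps step.IH] power])
qed

lemma multiples_preserved:
  assumes u: "u \<in> carrier_vec (n i)" and v: "v \<in> carrier_vec (n (i+1))"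
    and uv: "A i *\<^sub>v u = v \<or> B i *\<^sub>v v = u"
  shows "(\<lambda>y. A i *\<^sub>v y) ` multiples u \<subseteq> multiples v \<and> (\<lambda>y. B i *\<^sub>v y) ` multiples v \<subseteq> multiples u"
proof -
  obtain c where BA: "B i * A i = c \<cdot>\<^sub>m 1\<^sub>m (n i)" using BA_scalar by blast
  obtain d where AB: "A i * B i = d \<cdot>\<^sub>m 1\<^sub>m (n (i+1))" using AB_scalar by blast
  from uv have "A i *\<^sub>v u \<in> multiples v \<and> B i *\<^sub>v v \<in> multiples u"
  proof
    assume Au: "A i *\<^sub>v u = v"
    have "B i *\<^sub>v v = c \<cdot>\<^sub>v u"
      unfolding Au[symmetric] using A_carrier[of i] B_carrier[of i] u
      by (simp add: BA smult_one_mat_mult_vec flip: assoc_mult_mat_vec[of _ _ "n (i+1)"])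
    then show ?thesis using Au self_mem_multiples by blast
  next
    assume Bv: "B i *\<^sub>v v = u"
    have "A i *\<^sub>v u = d \<cdot>\<^sub>v v"
      unfolding Bv[symmetric] using A_carrier[of i] B_carrier[of i] v
      by (simp add: AB smult_one_mat_mult_vec flip: assoc_mult_mat_vec[of _ _ "n i"])
    then show ?thesis using Bv self_mem_multiples by blast
  qed
  then show ?thesis using mult_multiples_subset A_carrier B_carrier u v by blast
qed

end

locale special_line = smoothed_chain p t n A B for p :: "'r::idom \<Rightarrow> 'k::field" and t n A B +
  fixes W :: "int \<Rightarrow> 'k vec set"
  assumes subrep: "subrep n (\<lambda>i. map_mat p (A i)) (\<lambda>i. map_mat p (B i)) W"
    and exact: "exact_subrep n (\<lambda>i. map_mat p (A i)) (\<lambda>i. map_mat p (B i)) W"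
    and pure_dim: "pure_dim_one n W"
begin

lemma W_carrier: "W i \<subseteq> carrier_vec (n i)"
  using subrep by (simp add: subrep_def is_subspace_def)

lemma A_maps_W: "v \<in> W i \<Longrightarrow> map_mat p (A i) *\<^sub>v v \<in> W (i+1)"
  and B_maps_W: "v \<in> W (i+1) \<Longrightarrow> map_mat p (B i) *\<^sub>v v \<in> W i"
  using subrep unfolding subrep_def by blast+

lemma W_kernel_A: "v \<in> W i \<Longrightarrow> map_mat p (A i) *\<^sub>v v = 0\<^sub>v (n (i+1)) \<Longrightarrow> \<exists>y\<in>W (i+1). v = map_mat p (B i) *\<^sub>v y"
  using exact unfolding exact_subrep_def by blast

lemma W_line: "\<exists>w\<in>carrier_vec (n i). w \<noteq> 0\<^sub>v (n i) \<and> W i = multiples w"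
proof -
  obtain w where w: "w \<noteq> 0\<^sub>v (n i)" "W i = multiples w" using pure_dim unfolding pure_dim_one_def by blast
  then have "w \<in> carrier_vec (n i)" using W_carrier self_mem_multiples by blast
  then show ?thesis using w by blast
qed

definition lifts :: "int \<Rightarrow> 'r vec \<Rightarrow> bool" where
  "lifts i v \<longleftrightarrow> v \<in> carrier_vec (n i) \<and> W i = multiples (map_vec p v)"

definition forward :: "int \<Rightarrow> bool" where
  "forward i \<longleftrightarrow> (\<exists>w\<in>W i. map_mat p (A i) *\<^sub>v w \<noteq> 0\<^sub>v (n (i+1)))"

lemma lifts_residue_mem: "lifts i v \<Longrightarrow> map_vec p v \<in> W i"
  using self_mem_multiples by (auto simp: lifts_def)

lemma lifts_residue_nonzero:
  assumes "lifts i v"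
  shows "map_vec p v \<noteq> 0\<^sub>v (n i)"
proof
  assume v0: "map_vec p v = 0\<^sub>v (n i)"
  obtain w where w: "w \<in> carrier_vec (n i)" "w \<noteq> 0\<^sub>v (n i)" "W i = multiples w" using W_line by blast
  have "w \<in> multiples (map_vec p v)"
    using assms w(3) self_mem_multiples[of w] by (simp add: lifts_def)
  then show False using w(2) unfolding v0 by auto
qed

lemma lifts_add_smult_residue_zero:
  "lifts i v \<Longrightarrow> p c = 0 \<Longrightarrow> d \<in> carrier_vec (n i) \<Longrightarrow> lifts i (v + c \<cdot>\<^sub>v d)"
  unfolding lifts_def using map_vec_add_smult_residue_zero[of c v "n i" d] by auto

lemma lifts_forward:
  assumes fwd: "forward i" and v: "lifts i v"
  shows "lifts (i+1) (A i *\<^sub>v v)"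
proof -
  have vc: "v \<in> carrier_vec (n i)" using v by (simp add: lifts_def)
  have Av: "map_vec p (A i *\<^sub>v v) = map_mat p (A i) *\<^sub>v map_vec p v"
    using A_carrier vc by (rule mult_mat_vec_hom)
  obtain u where u: "u \<in> W i" "map_mat p (A i) *\<^sub>v u \<noteq> 0\<^sub>v (n (i+1))" using fwd by (auto simp: forward_def)
  obtain c where "u = c \<cdot>\<^sub>v map_vec p v" using u(1) v by (auto simp: lifts_def)
  then have "map_mat p (A i) *\<^sub>v u = c \<cdot>\<^sub>v map_vec p (A i *\<^sub>v v)"
    using A_carrier[of i] vc by (simp add: Av mult_mat_vec)
  then have nz: "map_vec p (A i *\<^sub>v v) \<noteq> 0\<^sub>v (n (i+1))" using u(2) by auto
  obtain w where w: "w \<in> carrier_vec (n (i+1))" "W (i+1) = multiples w" using W_line by blast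
  have "map_vec p (A i *\<^sub>v v) \<in> multiples w"
    using A_maps_W[OF lifts_residue_mem[OF v]] Av w(2) by simp
  then have "multiples (map_vec p (A i *\<^sub>v v)) = W (i+1)"
    unfolding w(2) by (rule multiples_eq_of_mem) (use nz w(1) in simp)
  then show ?thesis using A_carrier[of i] vc by (simp add: lifts_def)
qed

lemma backward_lift:
  assumes bwd: "\<not> forward i" and v: "lifts i v"
  shows "\<exists>Y e. lifts (i+1) Y \<and> e \<in> carrier_vec (n i) \<and> B i *\<^sub>v Y = v + t \<cdot>\<^sub>v e"
proof -
  have vc: "v \<in> carrier_vec (n i)" using v by (simp add: lifts_def)
  have "map_mat p (A i) *\<^sub>v map_vec p v = 0\<^sub>v (n (i+1))"
    using bwd lifts_residue_mem[OF v] by (auto simp: forward_def)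
  then obtain y where y: "y \<in> W (i+1)" and vy: "map_vec p v = map_mat p (B i) *\<^sub>v y"
    using W_kernel_A lifts_residue_mem[OF v] by blast
  have yc: "y \<in> carrier_vec (n (i+1))" using y W_carrier by blast
  have "y \<noteq> 0\<^sub>v (n (i+1))"
    using lifts_residue_nonzero[OF v] vy B_carrier[of i] by (auto simp: mult_mat_vec_zero)
  moreover obtain w where w: "w \<in> carrier_vec (n (i+1))" "W (i+1) = multiples w" using W_line by blast
  ultimately have Wy: "W (i+1) = multiples y"
    using y by (metis carrier_vecD multiples_eq_of_mem)
  obtain Y where Y: "Y \<in> carrier_vec (n (i+1))" "map_vec p Y = y" using exists_lift_vec[OF yc] by blast
  have BY: "B i *\<^sub>v Y \<in> carrier_vec (n i)" using B_carrier[of i] Y(1) by simp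
  have "map_vec p (B i *\<^sub>v Y) = map_vec p v"
    using vy Y B_carrier[of i] by (simp add: mult_mat_vec_hom)
  then obtain e where "e \<in> carrier_vec (n i)" "B i *\<^sub>v Y = v + t \<cdot>\<^sub>v e"
    using vec_eq_mod_uniformizer[OF BY vc] by blast
  moreover have "lifts (i+1) Y" using Y Wy by (simp add: lifts_def)
  ultimately show ?thesis by blast
qed

lemma lifts_backward:
  assumes bwd: "\<not> forward i" and x: "zigzag forward m i x" and i: "m \<le> i"
    and lifts_x: "\<And>k. m \<le> k \<Longrightarrow> k \<le> i \<Longrightarrow> lifts k (x k)"
  shows "\<exists>x'. zigzag forward m (i+1) x' \<and> (\<forall>k. m \<le> k \<and> k \<le> i+1 \<longrightarrow> lifts k (x' k))"
proof -
  have xi: "x i \<in> carrier_vec (n i)" using lifts_x i by (simp add: lifts_def)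
  obtain Y e where Y: "lifts (i+1) Y" and e: "e \<in> carrier_vec (n i)" and BY: "B i *\<^sub>v Y = x i + t \<cdot>\<^sub>v e"
    using backward_lift[OF bwd lifts_x[OF i order_refl]] by blast
  have Yc: "Y \<in> carrier_vec (n (i+1))" using Y by (simp add: lifts_def)
  obtain \<delta> z where \<delta>: "zigzag forward m i \<delta>" and z: "z \<in> carrier_vec (n (i+1))" and ez: "e = \<delta> i + B i *\<^sub>v z"
    using carrier_subset_end_span[OF i] e unfolding end_span_def by blast
  have \<delta>i: "\<delta> i \<in> carrier_vec (n i)" using zigzag_carrier[OF \<delta> i] by simp
  define y' where "y' = Y + (- t) \<cdot>\<^sub>v z"
  have "B i *\<^sub>v y' = x i + t \<cdot>\<^sub>v \<delta> i"
    using BY B_carrier[of i] Yc z xi \<delta>i unfolding y'_def ez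
    by (intro eq_vecI) (auto simp: mult_add_distrib_mat_vec mult_mat_vec_smult algebra_simps)
  then have "zigzag forward m (i+1) ((\<lambda>k. x k + t \<cdot>\<^sub>v \<delta> k)(i+1 := y'))"
    using bwd Yc z
    by (intro zigzag_extend[OF zigzag_add[OF x zigzag_smult[OF \<delta>]] i]) (simp_all add: y'_def linked_def)
  moreover have "lifts k (x k + t \<cdot>\<^sub>v \<delta> k)" if "m \<le> k" "k \<le> i" for k
    using lifts_add_smult_residue_zero lifts_x that zigzag_carrier[OF \<delta> that] by simp
  moreover have "lifts (i+1) y'"
    unfolding y'_def using lifts_add_smult_residue_zero[OF Y _ z] by (simp add: hom_uminus)
  ultimately show ?thesis by (intro exI[of _ "(\<lambda>k. x k + t \<cdot>\<^sub>v \<delta> k)(i+1 := y')"]) auto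
qed

lemma exists_lifting_zigzag:
  "m \<le> j \<Longrightarrow> \<exists>x. zigzag forward m j x \<and> (\<forall>k. m \<le> k \<and> k \<le> j \<longrightarrow> lifts k (x k))"
proof (induction j rule: int_ge_induct)
  case base
  obtain w where w: "w \<in> carrier_vec (n m)" "W m = multiples w" using W_line by blast
  obtain X where X: "X \<in> carrier_vec (n m)" "map_vec p X = w" using exists_lift_vec[OF w(1)] by blast
  have "lifts m X" using X w by (simp add: lifts_def)
  then show ?case using zigzag_single[OF X(1)] by (intro exI[of _ "\<lambda>_. X"]) auto
next
  case (step i)
  then obtain x where x: "zigzag forward m i x" and lifts_x: "\<forall>k. m \<le> k \<and> k \<le> i \<longrightarrow> lifts k (x k)"
    by blast
  show ?case
  proof (cases "forward i")
    case True
    have xi: "lifts i (x i)" using lifts_x step.hyps by simp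
    then have "zigzag forward m (i+1) (x(i+1 := A i *\<^sub>v x i))"
      using zigzag_extend[OF x step.hyps] True A_carrier[of i] by (simp add: lifts_def linked_def)
    moreover have "\<forall>k. m \<le> k \<and> k \<le> i+1 \<longrightarrow> lifts k ((x(i+1 := A i *\<^sub>v x i)) k)"
      using lifts_x lifts_forward[OF True xi] by auto
    ultimately show ?thesis by blast
  next
    case False
    then show ?thesis using lifts_backward x step.hyps lifts_x by blast
  qed
qed

lemma lifts_preimage_A:
  assumes inj: "inj_on ((*\<^sub>v) (map_mat p (A i))) (carrier_vec (n i))" and v: "lifts (i+1) v"
  shows "\<exists>u. lifts i u \<and> A i *\<^sub>v u = v"
proof -
  obtain d where d: "d \<noteq> 0" "A i * B i = d \<cdot>\<^sub>m 1\<^sub>m (n (i+1))" using AB_scalar by blast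
  obtain w where w: "w \<in> carrier_vec (n i)" "w \<noteq> 0\<^sub>v (n i)" "W i = multiples w" using W_line by blast
  have "w \<in> W i" using w(3) self_mem_multiples by blast
  have vc: "v \<in> carrier_vec (n (i+1))" and Wv: "W (i+1) = multiples (map_vec p v)" using v by (auto simp: lifts_def)
  have "map_mat p (A i) *\<^sub>v w \<in> multiples (map_vec p v)" using A_maps_W[OF \<open>w \<in> W i\<close>] Wv by simp
  then obtain u where "u \<in> carrier_vec (n i)" "A i *\<^sub>v u = v" "multiples w = multiples (map_vec p u)"
    using exists_line_preimage_of_residue_injective[OF A_carrier B_carrier d(2,1) inj vc w(1,2)] by blast
  then show ?thesis using w(3) by (auto simp: lifts_def)
qed

lemma lifts_preimage_B:
  assumes inj: "inj_on ((*\<^sub>v) (map_mat p (B i))) (carrier_vec (n (i+1)))" and v: "lifts i v"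
  shows "\<exists>u. lifts (i+1) u \<and> B i *\<^sub>v u = v"
proof -
  obtain c where c: "c \<noteq> 0" "B i * A i = c \<cdot>\<^sub>m 1\<^sub>m (n i)" using BA_scalar by blast
  obtain w where w: "w \<in> carrier_vec (n (i+1))" "w \<noteq> 0\<^sub>v (n (i+1))" "W (i+1) = multiples w" using W_line by blast
  have "w \<in> W (i+1)" using w(3) self_mem_multiples by blast
  have vc: "v \<in> carrier_vec (n i)" and Wv: "W i = multiples (map_vec p v)" using v by (auto simp: lifts_def)
  have "map_mat p (B i) *\<^sub>v w \<in> multiples (map_vec p v)" using B_maps_W[OF \<open>w \<in> W (i+1)\<close>] Wv by simp
  then obtain u where "u \<in> carrier_vec (n (i+1))" "B i *\<^sub>v u = v" "multiples w = multiples (map_vec p u)"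
    using exists_line_preimage_of_residue_injective[OF B_carrier A_carrier c(2,1) inj vc w(1,2)] by blast
  then show ?thesis using w(3) by (auto simp: lifts_def)
qed

lemma exists_lifted_subrep:
  assumes "finite_cosupport n (\<lambda>i. map_mat p (A i)) (\<lambda>i. map_mat p (B i)) H"
  shows "\<exists>x. \<forall>i. lifts i (x i) \<and> (\<lambda>y. A i *\<^sub>v y) ` multiples (x i) \<subseteq> multiples (x (i+1)) \<and>
           (\<lambda>y. B i *\<^sub>v y) ` multiples (x (i+1)) \<subseteq> multiples (x i)"
proof -
  have "is_rep n (\<lambda>i. map_mat p (A i)) (\<lambda>i. map_mat p (B i))"
    using A_carrier B_carrier by (simp add: is_rep_def)
  then obtain m M where mM: "m \<le> M"
    and injA: "\<And>i. i < m \<Longrightarrow> inj_on ((*\<^sub>v) (map_mat p (A i))) (carrier_vec (n i))"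
    and injB: "\<And>i. M \<le> i \<Longrightarrow> inj_on ((*\<^sub>v) (map_mat p (B i))) (carrier_vec (n (i+1)))"
    using finite_cosupport_bounds[OF _ assms] by blast
  obtain z where z: "zigzag forward m M z" and lifts_z: "\<forall>i. m \<le> i \<and> i \<le> M \<longrightarrow> lifts i (z i)"
    using exists_lifting_zigzag[OF mM] by blast
  have "\<exists>x. \<forall>i. lifts i (x i) \<and> (A i *\<^sub>v x i = x (i+1) \<or> B i *\<^sub>v x (i+1) = x i)"
  proof (rule int_seq_choice[OF mM])
    show "\<exists>x. \<forall>i. m \<le> i \<and> i \<le> M \<longrightarrow>
        lifts i (x i) \<and> (i < M \<longrightarrow> A i *\<^sub>v x i = x (i+1) \<or> B i *\<^sub>v x (i+1) = x i)"
      using z lifts_z by (intro exI[of _ z]) (auto simp: zigzag_def linked_def split: if_splits)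
  qed (use lifts_preimage_A[OF injA] lifts_preimage_B[OF injB] in metis)+
  then obtain x where x: "\<And>i. lifts i (x i)" "\<And>i. A i *\<^sub>v x i = x (i+1) \<or> B i *\<^sub>v x (i+1) = x i"
    by blast
  then show ?thesis using multiples_preserved by (meson lifts_def)
qed

end

lemma ring_hom_of_is_ring_hom:
  assumes "is_ring_hom (f :: 'a::ring_1 \<Rightarrow> 'b::ring_1)"
  shows "Ring_Hom.ring_hom f"
proof -
  have f: "f (x + y) = f x + f y" "f (x * y) = f x * f y" "f 1 = 1" for x y
    using assms unfolding is_ring_hom_def by auto
  have "f 0 = 0" using f(1)[of 0 0] by simp
  then show ?thesis by unfold_locales (use f in auto)
qed

lemma dvr_residue_of_is_dvr:
  assumes "is_dvr TYPE('r::idom)" and "is_residue_map (\<pi> :: 'r \<Rightarrow> 'k::field)"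
  shows "\<exists>t. dvr_residue \<pi> t"
  using assms ring_hom_of_is_ring_hom
  by (auto simp: is_dvr_def is_residue_map_def dvr_residue_def dvr_residue_axioms_def)

lemma scalar_mat_of_map_mat:
  fixes \<iota> :: "'r::idom \<Rightarrow> 'K::field"
  assumes hom: "Ring_Hom.ring_hom \<iota>" and inj: "inj \<iota>" and M: "M \<in> carrier_mat N N"
    and Mc: "map_mat \<iota> M = c \<cdot>\<^sub>m 1\<^sub>m N" and c: "c \<noteq> 0"
  shows "\<exists>r. r \<noteq> 0 \<and> M = r \<cdot>\<^sub>m 1\<^sub>m N"
proof (cases "N = 0")
  case True
  then show ?thesis using M by (intro exI[of _ 1]) auto
next
  case False
  interpret ring_hom \<iota> by (rule hom)
  have entries: "\<iota> (M $$ (k, l)) = (if k = l then c else 0)" if "k < N" "l < N" for k l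
    using arg_cong[OF Mc, of "\<lambda>X. X $$ (k, l)"] M that by simp
  define r where "r = M $$ (0, 0)"
  have r: "\<iota> r = c" using entries[of 0 0] False by (simp add: r_def)
  have "M = r \<cdot>\<^sub>m 1\<^sub>m N"
  proof (rule eq_matI)
    fix k l assume "k < dim_row (r \<cdot>\<^sub>m 1\<^sub>m N)" "l < dim_col (r \<cdot>\<^sub>m 1\<^sub>m N)"
    then have "\<iota> (M $$ (k, l)) = \<iota> ((r \<cdot>\<^sub>m 1\<^sub>m N) $$ (k, l))" using entries r by auto
    then show "M $$ (k, l) = (r \<cdot>\<^sub>m 1\<^sub>m N) $$ (k, l)" using inj by (simp add: inj_eq)
  qed (use M in auto)
  moreover have "r \<noteq> 0" using r c by auto
  ultimately show ?thesis by blast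
qed

lemma scalars_of_general_rep:
  fixes \<iota> :: "'r::idom \<Rightarrow> 'K::field"
  assumes \<iota>: "is_fraction_field_map \<iota>" and rep: "is_rep n A B"
    and gen: "general_rep n (\<lambda>i. map_mat \<iota> (A i)) (\<lambda>i. map_mat \<iota> (B i))"
  shows "\<exists>c. c \<noteq> 0 \<and> B i * A i = c \<cdot>\<^sub>m 1\<^sub>m (n i)"
    and "\<exists>d. d \<noteq> 0 \<and> A i * B i = d \<cdot>\<^sub>m 1\<^sub>m (n (i+1))"
proof -
  have hom: "Ring_Hom.ring_hom \<iota>" and inj: "inj \<iota>"
    using \<iota> ring_hom_of_is_ring_hom by (auto simp: is_fraction_field_map_def)
  interpret ring_hom \<iota> by (rule hom)
  have A: "A i \<in> carrier_mat (n (i+1)) (n i)" and B: "B i \<in> carrier_mat (n i) (n (i+1))"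
    using rep by (auto simp: is_rep_def)
  have "(\<exists>c. c \<noteq> 0 \<and> map_mat \<iota> (B i) * map_mat \<iota> (A i) = c \<cdot>\<^sub>m 1\<^sub>m (n i)) \<and>
      (\<exists>d. d \<noteq> 0 \<and> map_mat \<iota> (A i) * map_mat \<iota> (B i) = d \<cdot>\<^sub>m 1\<^sub>m (n (i+1)))"
    using gen unfolding general_rep_def by blast
  then obtain c d where "c \<noteq> 0" "map_mat \<iota> (B i) * map_mat \<iota> (A i) = c \<cdot>\<^sub>m 1\<^sub>m (n i)"
    and "d \<noteq> 0" "map_mat \<iota> (A i) * map_mat \<iota> (B i) = d \<cdot>\<^sub>m 1\<^sub>m (n (i+1))"
    by blast
  then show "\<exists>c. c \<noteq> 0 \<and> B i * A i = c \<cdot>\<^sub>m 1\<^sub>m (n i)"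
    and "\<exists>d. d \<noteq> 0 \<and> A i * B i = d \<cdot>\<^sub>m 1\<^sub>m (n (i+1))"
    using scalar_mat_of_map_mat[OF hom inj] A B by (simp_all add: mat_hom_mult)
qed

theorem lemma4p1:
  fixes \<pi> :: "'r::idom \<Rightarrow> 'k::field" and \<iota> :: "'r \<Rightarrow> 'K::field"
    and n :: "int \<Rightarrow> nat" and A B :: "int \<Rightarrow> 'r mat"
    and W :: "int \<Rightarrow> 'k vec set"
  assumes "is_dvr TYPE('r)"
    and "is_residue_map \<pi>"
    and "is_fraction_field_map \<iota>"
    and "is_rep n A B"
    and "general_rep n (\<lambda>i. map_mat \<iota> (A i)) (\<lambda>i. map_mat \<iota> (B i))"
    and "colinked_chain n (\<lambda>i. map_mat \<pi> (A i)) (\<lambda>i. map_mat \<pi> (B i))"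
    and "\<exists>H. finite_cosupport n (\<lambda>i. map_mat \<pi> (A i)) (\<lambda>i. map_mat \<pi> (B i)) H"
    and "subrep n (\<lambda>i. map_mat \<pi> (A i)) (\<lambda>i. map_mat \<pi> (B i)) W"
    and "exact_subrep n (\<lambda>i. map_mat \<pi> (A i)) (\<lambda>i. map_mat \<pi> (B i)) W"
    and "pure_dim_one n W"
  shows "\<exists>x :: int \<Rightarrow> 'r vec.
           (\<forall>i. x i \<in> carrier_vec (n i) \<and> W i = {c \<cdot>\<^sub>v map_vec \<pi> (x i) | c. True}) \<and>
           (let Wt = (\<lambda>i. {r \<cdot>\<^sub>v x i | r. True}) in
             \<forall>i. (\<lambda>y. A i *\<^sub>v y) ` Wt i \<subseteq> Wt (i+1) \<and> (\<lambda>y. B i *\<^sub>v y) ` Wt (i+1) \<subseteq> Wt i)"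
proof -
  obtain t where "dvr_residue \<pi> t" using dvr_residue_of_is_dvr[OF assms(1,2)] by blast
  then interpret special_line \<pi> t n A B W
    using assms(4,6,8-10) scalars_of_general_rep[OF assms(3-5)]
    by (intro special_line.intro smoothed_chain.intro smoothed_chain_axioms.intro special_line_axioms.intro)
  obtain H where "finite_cosupport n (\<lambda>i. map_mat \<pi> (A i)) (\<lambda>i. map_mat \<pi> (B i)) H"
    using assms(7) by blast
  from exists_lifted_subrep[OF this] obtain x where "\<forall>i. lifts i (x i) \<and>
      (\<lambda>y. A i *\<^sub>v y) ` multiples (x i) \<subseteq> multiples (x (i+1)) \<and>
      (\<lambda>y. B i *\<^sub>v y) ` multiples (x (i+1)) \<subseteq> multiples (x i)" by blast
  then show ?thesis unfolding Let_def lifts_def by (intro exI[of _ x]) blast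
qed

end
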